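(* Let $d\ge3$, $n\ge2$, $\mathcal{A}\in\mathbb{R}^{n\times n\times\cdots\times n}$ a symmetric tensor of order $d$, $0<\eta\le\frac2n$, and let $f_s\colon O_n\to\mathbb{R}$ be $$f_s(U)=\operatorname{tr}(\mathcal{A}\times_1U^T\times_2U^T\cdots\times_dU^T).$$ Let $\{U^{(k)}\}_{k\ge0}$ be a sequence generated by the symmetry-preserving trace maximization Jacobi-type algorithm with parameter $\eta$ (described in the context), for any cyclic pivot ordering. Then every accumulation point $U$ of this sequence is a stationary point of $f_s$, i.e. $\nabla f_s(U)=0$.
   Context: $O_n$ is the set of real orthogonal $n\times n$ matrices. For matrices $\langle X,Y\rangle=\sum_{i,j}X_{ij}Y_{ij}$, and $\|\cdot\|_2$ is the matrix 2-norm (spectral norm). Tensor notation: a tensor is symmetric if its entries are invariant under all permutations of the indices. The mode-$m$ product $\mathcal{A}\times_m X$ has entries $(\mathcal{A}\times_mX)_{i_1\ldots i_{m-1}\,j\,i_{m+1}\ldots i_d}=\sum_{i_m}X_{j i_m}a_{i_1\ldots i_d}$. The trace is $\operatorname{tr}(\mathcal{S})=\sum_{i=1}^n\mathcal{S}_{ii\cdots i}$. Thus $f_s(U)=\sum_{r=1}^n\sum_{i_1,\ldots,i_d=1}^n a_{i_1\ldots i_d}u_{i_1r}\cdots u_{i_dr}$. Gradient: let $\tilde f_s$ be the extension of $f_s$ by the same formula to all real $n\times n$ matrices and $\nabla\tilde f_s(U)$ the matrix of its partial derivatives. Then $\nabla f_s(U)=U\Lambda(U)$ with $\Lambda(U)=\frac12\left(U^T\nabla\tilde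 f_s(U)-(\nabla\tilde f_s(U))^TU\right)$ (projection onto the tangent space of $O_n$ at $U$). A stationary point is $U\in O_n$ with $\nabla f_s(U)=0$. Rotations: for $1\le i<j\le n$, $R(i,j,\phi)$ is the $n\times n$ matrix equal to the identity except for the entries $R_{ii}=R_{jj}=\cos\phi$, $R_{ij}=-\sin\phi$, $R_{ji}=\sin\phi$; $\dot R(i,j,0)=\frac{\partial}{\partial\phi}R(i,j,\phi)|_{\phi=0}$. Algorithm: start from $U^{(0)}=I$. Fix an ordering of all pairs $(i,j)$, $1\le i<j\le n$, and run through it repeatedly (a cyclic pivot strategy). At the current point $U^{(k)}$, if the next pair $(i,j)$ in the ordering fails the pivot condition $$|\langle\nabla f_s(U^{(k)}),U^{(k)}\dot R(i,j,0)\rangle|\ge\eta\|\nabla f_s(U^{(k)})\|_2,$$ it is skipped and one moves to the next pair (without increasing $k$); otherwise it becomes the pivot pair $(i_k,j_k)$, and one sets $U^{(k+1)}=U^{(k)}R(i_k,j_k,\phi_k)$, where $\phi_k$ is chosen to maximize $\phi\mapsto f_s(U^{(k)}R(i_k,j_k,\phi))$ over $\mathbb{R}$. The algorithm is run indefinitely. An accumulation point is the limit of a subsequence of $\{U^{(k)}\}$. *)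

theory Defs
  imports "HOL-Analysis.Analysis" "HOL-Combinatorics.Permutations"
begin

text \<open>
  An \<open>n \<times> \<dots> \<times> n\<close> tensor of order \<open>d\<close> is a function on index lists; only its values on lists of
  length \<open>d\<close> matter.  Modes are numbered \<open>0, \<dots>, d - 1\<close>.  The index set \<open>{1, \<dots>, n}\<close> is a
  finite linearly ordered type \<open>'n\<close> with \<open>n = CARD('n)\<close>.
\<close>

definition symmetric_tensor :: "nat \<Rightarrow> ('n list \<Rightarrow> real) \<Rightarrow> bool" where
  "symmetric_tensor d A \<longleftrightarrow>
     (\<forall>is p. length is = d \<longrightarrow> p permutes {..<d} \<longrightarrow> A (permute_list p is) = A is)"

definition mode_product ::
    "nat \<Rightarrow> real^'n^'n \<Rightarrow> ('n::finite list \<Rightarrow> real) \<Rightarrow> ('n list \<Rightarrow> real)" where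
  "mode_product m X A = (\<lambda>is. \<Sum>k\<in>UNIV. X $ (is ! m) $ k * A (is[m := k]))"

definition tensor_trace :: "nat \<Rightarrow> ('n::finite list \<Rightarrow> real) \<Rightarrow> real" where
  "tensor_trace d S = (\<Sum>i\<in>UNIV. S (replicate d i))"

text \<open>
  The same formula serves as \<open>f\<^sub>s\<close> on orthogonal matrices and as its extension to all
  matrices.
\<close>

definition trace_fun :: "nat \<Rightarrow> ('n::finite list \<Rightarrow> real) \<Rightarrow> real^'n^'n \<Rightarrow> real" where
  "trace_fun d A U = tensor_trace d (fold (\<lambda>m. mode_product m (transpose U)) [0..<d] A)"

definition euclidean_gradient ::
    "(real^'n^'n \<Rightarrow> real) \<Rightarrow> real^'n^'n \<Rightarrow> real^'n^'n" where
  "euclidean_gradient f U =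
     (\<chi> i j. deriv (\<lambda>x. f (\<chi> k l. if k = i \<and> l = j then x else U $ k $ l)) (U $ i $ j))"

text \<open>The projection of the Euclidean gradient onto the tangent space of \<open>O\<^sub>n\<close> at \<open>U\<close>.\<close>

definition orthogonal_gradient ::
    "(real^'n^'n \<Rightarrow> real) \<Rightarrow> real^'n^'n \<Rightarrow> real^'n^'n" where
  "orthogonal_gradient f U =
     (let G = euclidean_gradient f U
      in U ** ((1/2) *\<^sub>R (transpose U ** G - transpose G ** U)))"

definition stationary_point :: "(real^'n^'n \<Rightarrow> real) \<Rightarrow> real^'n^'n \<Rightarrow> bool" where
  "stationary_point f U \<longleftrightarrow> orthogonal_matrix U \<and> orthogonal_gradient f U = 0"

definition rotation :: "'n \<Rightarrow> 'n \<Rightarrow> real \<Rightarrow> real^'n^'n" where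
  "rotation i j \<phi> = (\<chi> k l.
     if k = i \<and> l = i \<or> k = j \<and> l = j then cos \<phi>
     else if k = i \<and> l = j then - sin \<phi>
     else if k = j \<and> l = i then sin \<phi>
     else if k = l then 1 else 0)"

text \<open>
  The inner product on \<^typ>\<open>real^'n^'n\<close> is the entrywise one, and the operator norm
  of \<open>X\<close> acting on Euclidean space is the spectral norm.
\<close>

definition pivot_condition ::
    "(real^'n^'n \<Rightarrow> real) \<Rightarrow> real \<Rightarrow> real^'n^'n \<Rightarrow> 'n \<times> 'n \<Rightarrow> bool" where
  "pivot_condition f \<eta> U = (\<lambda>(i, j).
     \<bar>orthogonal_gradient f U \<bullet> (U ** vector_derivative (rotation i j) (at 0))\<bar>
       \<ge> \<eta> * onorm ((*v) (orthogonal_gradient f U)))"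

definition pivot_ordering :: "('n::linorder \<times> 'n) list \<Rightarrow> bool" where
  "pivot_ordering ps \<longleftrightarrow> distinct ps \<and> set ps = {(i, j). i < j}"

text \<open>
  The cyclic sweep visits the pair \<open>ps ! (t mod length ps)\<close> at time \<open>t\<close>.  In iteration \<open>k\<close> the
  search for a pivot starts at time \<open>s k\<close> and stops at time \<open>q k\<close>, the first one whose pair
  satisfies the pivot condition at the current iterate; the next search resumes right after it.
\<close>

definition jacobi_sequence ::
    "(real^'n^'n \<Rightarrow> real) \<Rightarrow> real \<Rightarrow> ('n \<times> 'n) list
      \<Rightarrow> (nat \<Rightarrow> real^'n^'n) \<Rightarrow> bool" where
  "jacobi_sequence f \<eta> ps Us \<longleftrightarrow>
     Us 0 = mat 1 \<and>
     (\<exists>s q :: nat \<Rightarrow> nat. \<exists>\<phi> :: nat \<Rightarrow> real.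
        s 0 = 0 \<and>
        (\<forall>k. s (Suc k) = Suc (q k) \<and> s k \<le> q k \<and>
             (\<forall>t. s k \<le> t \<and> t < q k \<longrightarrow> \<not> pivot_condition f \<eta> (Us k) (ps ! (t mod length ps))) \<and>
             pivot_condition f \<eta> (Us k) (ps ! (q k mod length ps)) \<and>
             (case ps ! (q k mod length ps) of (i, j) \<Rightarrow>
                (\<forall>\<psi>. f (Us k ** rotation i j \<psi>) \<le> f (Us k ** rotation i j (\<phi> k))) \<and>
                Us (Suc k) = Us k ** rotation i j (\<phi> k))))"

end

theory Submission
  imports Defs
begin

text \<open>
  The values \<open>f (Us k)\<close> increase, so none of them exceeds \<open>f U\<close>.  Suppose that the gradient at \<open>U\<close>
  is nonzero.  If the slope at \<open>0\<close> of \<open>\<psi> \<mapsto> f (U R(i,j,\<psi>))\<close> vanishes, then by continuity the pivot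
  condition for \<open>(i, j)\<close> fails at all iterates close to \<open>U\<close>.  If it does not vanish, then
  some angle \<open>\<psi>\<close> gives \<open>f (U R(i,j,\<psi>)) > f U\<close>, and by continuity and the maximality of the chosen
  angle, a step with pivot \<open>(i, j)\<close> from an iterate close to \<open>U\<close> would exceed \<open>f U\<close>.  As there are
  only finitely many pairs, no pivot remains for the iterates near \<open>U\<close>.
\<close>

section \<open>Matrices\<close>

lemma tendsto_matrix_mult [tendsto_intros]:
  fixes A :: "real^'n^'m" and B :: "real^'p^'n"
  assumes "(f \<longlongrightarrow> A) F" "(g \<longlongrightarrow> B) F"
  shows "((\<lambda>x. f x ** g x) \<longlongrightarrow> A ** B) F"
  unfolding matrix_matrix_mult_def
  by (intro tendsto_vec_lambda tendsto_intros assms)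

lemma tendsto_matrix_vector_mult [tendsto_intros]:
  fixes A :: "real^'n^'m"
  assumes "(f \<longlongrightarrow> A) F"
  shows "((\<lambda>x. f x *v v) \<longlongrightarrow> A *v v) F"
  unfolding matrix_vector_mult_def
  by (intro tendsto_vec_lambda tendsto_intros assms)

lemma tendsto_transpose [tendsto_intros]:
  fixes A :: "real^'n^'m"
  assumes "(f \<longlongrightarrow> A) F"
  shows "((\<lambda>x. transpose (f x)) \<longlongrightarrow> transpose A) F"
  unfolding transpose_def
  by (intro tendsto_vec_lambda tendsto_intros assms)

lemma matrix_mult_scaleR:
  fixes A :: "real^'n^'m" and B :: "real^'p^'n"
  shows "A ** (c *\<^sub>R B) = c *\<^sub>R (A ** B)"
  by (simp add: vec_eq_iff matrix_matrix_mult_def sum_distrib_left mult_ac)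

text \<open>Left multiplication by \<open>Y\<close> has left multiplication by
  \<open>transpose Y\<close> as its adjoint. For orthogonal \<open>Y = U\<close> this lets the
  factor \<open>U\<close> of a tangent vector be cancelled.\<close>

lemma inner_matrix_mult_right:
  fixes X :: "real^'p^'m" and Y :: "real^'n^'m" and Z :: "real^'p^'n"
  shows "X \<bullet> (Y ** Z) = (transpose Y ** X) \<bullet> Z"
proof -
  have "X \<bullet> (Y ** Z) = (\<Sum>i\<in>UNIV. \<Sum>j\<in>UNIV. \<Sum>k\<in>UNIV. X$i$j * (Y$i$k * Z$k$j))"
    by (simp add: inner_vec_def matrix_matrix_mult_def sum_distrib_left)
  also have "\<dots> = (\<Sum>i\<in>UNIV. \<Sum>k\<in>UNIV. \<Sum>j\<in>UNIV. X$i$j * (Y$i$k * Z$k$j))"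
    by (intro sum.cong refl sum.swap)
  also have "\<dots> = (\<Sum>k\<in>UNIV. \<Sum>i\<in>UNIV. \<Sum>j\<in>UNIV. X$i$j * (Y$i$k * Z$k$j))"
    by (rule sum.swap)
  also have "\<dots> = (\<Sum>k\<in>UNIV. \<Sum>j\<in>UNIV. \<Sum>i\<in>UNIV. X$i$j * (Y$i$k * Z$k$j))"
    by (intro sum.cong refl sum.swap)
  also have "\<dots> = (transpose Y ** X) \<bullet> Z"
    by (simp add: inner_vec_def matrix_matrix_mult_def transpose_def sum_distrib_left mult_ac)
  finally show ?thesis .
qed

lemma inner_transpose:
  fixes X Y :: "real^'n^'m"
  shows "transpose X \<bullet> transpose Y = X \<bullet> Y"
  unfolding inner_vec_def transpose_def by (simp, rule sum.swap)

lemma orthogonal_matrix_limit: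
  fixes X :: "nat \<Rightarrow> real^'n^'n"
  assumes "\<And>k. orthogonal_matrix (X k)" "X \<longlonglongrightarrow> U"
  shows "orthogonal_matrix U"
proof -
  have "(\<lambda>k. transpose (X k) ** X k) \<longlonglongrightarrow> transpose U ** U"
    by (intro tendsto_intros assms)
  moreover have "(\<lambda>k. transpose (X k) ** X k) = (\<lambda>k. mat 1)"
    using assms(1) by (simp add: orthogonal_matrix)
  ultimately show ?thesis
    by (simp add: orthogonal_matrix LIMSEQ_const_iff)
qed

section \<open>Plane rotations\<close>

text \<open>For \<open>i \<noteq> j\<close> this is the derivative of the plane rotation at angle 0,
  in closed form, so that it can replace the \<open>vector_derivative\<close> in the pivot
  condition.\<close>

definition rotation_generator :: "'n \<Rightarrow> 'n \<Rightarrow> real^'n^'n" where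
  "rotation_generator i j =
     (\<chi> k l. if k = i \<and> l = j then -1 else if k = j \<and> l = i then 1 else 0)"

lemma transpose_rotation_generator:
  assumes "i \<noteq> j"
  shows "transpose (rotation_generator i j) = - rotation_generator i j"
  unfolding vec_eq_iff transpose_def rotation_generator_def using assms by auto

lemma rotation_0:
  fixes i j :: "'n::finite"
  assumes "i \<noteq> j"
  shows "(rotation i j 0 :: real^'n^'n) = mat 1"
proof -
  have "(rotation i j 0 :: real^'n^'n) $ k $ l = mat 1 $ k $ l" for k l
    using assms by (cases "k = i"; cases "k = j"; cases "l = i"; cases "l = j")
      (simp_all add: rotation_def mat_def)
  then show ?thesis
    by (simp add: vec_eq_iff)
qed

lemma has_vector_derivative_rotation:
  fixes i j :: "'n::finite"
  assumes "i \<noteq> j"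
  shows "(rotation i j has_vector_derivative rotation_generator i j) (at 0)"
proof -
  \<comment> \<open>\<open>D\<close> projects onto the plane of the axes \<open>i\<close> and
    \<open>j\<close>. Splitting the rotation into the identity off this plane, a cosine part and a
    sine part makes the angle appear only in scalar factors.\<close>
  define D :: "real^'n^'n" where "D = (\<chi> k l. if k = l \<and> (k = i \<or> k = j) then 1 else 0)"
  have "rotation i j \<phi> $ k $ l =
      ((mat 1 - D) + cos \<phi> *\<^sub>R D + sin \<phi> *\<^sub>R rotation_generator i j) $ k $ l" for \<phi> k l
    using assms by (cases "k = i"; cases "k = j"; cases "l = i"; cases "l = j")
      (simp_all add: rotation_def D_def rotation_generator_def mat_def)
  then have eq: "rotation i j =
      (\<lambda>\<phi>. (mat 1 - D) + cos \<phi> *\<^sub>R D + sin \<phi> *\<^sub>R rotation_generator i j)"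
    by (simp add: fun_eq_iff vec_eq_iff)
  show ?thesis
    unfolding eq by (auto intro!: derivative_eq_intros)
qed

lemma orthogonal_matrix_rotation:
  fixes i j :: "'n::finite"
  assumes "i \<noteq> j"
  shows "orthogonal_matrix (rotation i j \<phi> :: real^'n^'n)"
proof -
  have col: "column l (rotation i j \<phi> :: real^'n^'n) =
      (if l = i then cos \<phi> *\<^sub>R axis i 1 + sin \<phi> *\<^sub>R axis j 1
       else if l = j then cos \<phi> *\<^sub>R axis j 1 - sin \<phi> *\<^sub>R axis i 1
       else axis l 1)" for l
  proof -
    have "(rotation i j \<phi> :: real^'n^'n) $ k $ l = (if l = i then cos \<phi> *\<^sub>R axis i 1 + sin \<phi> *\<^sub>R axis j 1
       else if l = j then cos \<phi> *\<^sub>R axis j 1 - sin \<phi> *\<^sub>R axis i 1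
       else axis l 1) $ k" for k
      using assms by (cases "k = i"; cases "k = j"; cases "l = i"; cases "l = j")
        (simp_all add: rotation_def axis_def)
    then show ?thesis
      by (simp add: vec_eq_iff column_def)
  qed
  have "cos \<phi> * cos \<phi> + sin \<phi> * sin \<phi> = 1"
    using sin_cos_squared_add[of \<phi>] by (simp add: power2_eq_square)
  then have "column a (rotation i j \<phi> :: real^'n^'n) \<bullet> column b (rotation i j \<phi>) = (if a = b then 1 else 0)"
    for a b
    using assms unfolding col
    by (simp add: inner_axis_axis inner_add_left inner_add_right inner_diff_left inner_diff_right add.commute)
  then show ?thesis
    by (simp add: orthogonal_matrix matrix_mult_transpose_dot_column vec_eq_iff mat_def)
qed

section \<open>Continuously differentiable functions of a matrix\<close>

text \<open>The gradient is the vector representing the total derivative, not a table of partial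
  derivatives; sum, product and chain rules then apply directly.\<close>

definition has_continuous_gradient :: "('a::real_inner \<Rightarrow> real) \<Rightarrow> ('a \<Rightarrow> 'a) \<Rightarrow> bool" where
  "has_continuous_gradient f g \<longleftrightarrow>
     (\<forall>x. (f has_derivative (\<lambda>h. g x \<bullet> h)) (at x)) \<and> continuous_on UNIV g"

definition C1 :: "('a::real_inner \<Rightarrow> real) \<Rightarrow> bool" where
  "C1 f \<longleftrightarrow> (\<exists>g. has_continuous_gradient f g)"

lemma has_continuous_gradient_isCont:
  assumes "has_continuous_gradient f g"
  shows "isCont f x" "isCont g x"
  using assms has_derivative_continuous continuous_on_eq_continuous_at[OF open_UNIV]
  unfolding has_continuous_gradient_def by blast+

lemma C1_const: "C1 (\<lambda>x. c)"
  unfolding C1_def has_continuous_gradient_def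
  by (rule exI[of _ "\<lambda>x. 0"]) (auto simp: fun_eq_iff intro!: has_derivative_eq_rhs[OF has_derivative_const])

lemma C1_inner_left: "C1 (\<lambda>x. v \<bullet> x)"
  unfolding C1_def has_continuous_gradient_def
  by (rule exI[of _ "\<lambda>x. v"]) (auto intro!: derivative_eq_intros)

lemma C1_add:
  assumes "C1 f" "C1 g"
  shows "C1 (\<lambda>x. f x + g x)"
proof -
  obtain f' g' where "has_continuous_gradient f f'" "has_continuous_gradient g g'"
    using assms by (auto simp: C1_def)
  then have "has_continuous_gradient (\<lambda>x. f x + g x) (\<lambda>x. f' x + g' x)"
    unfolding has_continuous_gradient_def
    by (auto simp: fun_eq_iff inner_add_left
        intro!: has_derivative_eq_rhs[OF has_derivative_add] continuous_intros)
  then show ?thesis by (auto simp: C1_def)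
qed

lemma C1_mult:
  assumes "C1 f" "C1 g"
  shows "C1 (\<lambda>x. f x * g x)"
proof -
  obtain f' g' where fg: "has_continuous_gradient f f'" "has_continuous_gradient g g'"
    using assms by (auto simp: C1_def)
  then have "continuous_on UNIV f" "continuous_on UNIV g"
    by (auto intro!: continuous_at_imp_continuous_on has_continuous_gradient_isCont)
  moreover have "((\<lambda>x. f x * g x) has_derivative (\<lambda>h. (f x *\<^sub>R g' x + g x *\<^sub>R f' x) \<bullet> h)) (at x)" for x
  proof -
    have "(f has_derivative (\<lambda>h. f' x \<bullet> h)) (at x)" "(g has_derivative (\<lambda>h. g' x \<bullet> h)) (at x)"
      using fg by (auto simp: has_continuous_gradient_def)
    from has_derivative_mult[OF this] show ?thesis
      by (simp add: inner_add_left mult_ac)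
  qed
  ultimately have "has_continuous_gradient (\<lambda>x. f x * g x) (\<lambda>x. f x *\<^sub>R g' x + g x *\<^sub>R f' x)"
    using fg unfolding has_continuous_gradient_def
    by (auto intro!: continuous_intros)
  then show ?thesis by (auto simp: C1_def)
qed

lemma C1_sum:
  assumes "\<And>i. i \<in> S \<Longrightarrow> C1 (f i)"
  shows "C1 (\<lambda>x. \<Sum>i\<in>S. f i x)"
  using assms by (induction S rule: infinite_finite_induct) (auto intro: C1_const C1_add)

lemma C1_entry: "C1 (\<lambda>X :: real^'n^'m. X $ i $ j)"
proof -
  have "(\<lambda>X :: real^'n^'m. X $ i $ j) = (\<lambda>X. axis i (axis j 1) \<bullet> X)"
    by (simp add: fun_eq_iff inner_axis' )
  then show ?thesis by (simp add: C1_inner_left)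
qed

text \<open>Every entry is a polynomial in the entries of \<open>U\<close>. The index list is
  arbitrary in the induction because the last mode product evaluates the previous tensor at lists
  with one position changed.\<close>

lemma C1_fold_mode_product:
  "C1 (\<lambda>U :: real^'n^'n. fold (\<lambda>m. mode_product m (transpose U)) [0..<d] A is)"
proof (induction d arbitrary: "is")
  case 0
  show ?case by (simp add: C1_const)
next
  case (Suc d)
  then show ?case
    by (auto simp: mode_product_def transpose_def intro!: C1_sum C1_mult C1_entry)
qed

lemma C1_trace_fun: "C1 (trace_fun d A)"
  unfolding trace_fun_def tensor_trace_def by (intro C1_sum C1_fold_mode_product)

text \<open>Links the total derivative to the entrywise \<open>deriv\<close>: varying one entry
  moves along a straight line, so the chain rule yields the matching entry of
  \<open>g U\<close>.\<close>

lemma has_continuous_gradient_imp_euclidean_gradient: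
  fixes f :: "real^'n^'n \<Rightarrow> real"
  assumes "has_continuous_gradient f g"
  shows "euclidean_gradient f = g"
proof -
  have "deriv (\<lambda>x. f (\<chi> k l. if k = i \<and> l = j then x else U $ k $ l)) (U $ i $ j) = g U $ i $ j"
    for U i j
  proof (rule DERIV_imp_deriv)
    define E :: "real^'n^'n" where "E = axis i (axis j 1)"
    have eq: "(\<chi> k l. if k = i \<and> l = j then x else U $ k $ l) = U + (x - U $ i $ j) *\<^sub>R E" for x
      by (auto simp: vec_eq_iff E_def axis_def)
    \<comment> \<open>The base point is \<open>U\<close> itself, written as the value of the line at
      \<open>x = U $ i $ j\<close> to fit the chain rule.\<close>
    have "(f has_derivative (\<lambda>h. g U \<bullet> h)) (at (U + (U $ i $ j - U $ i $ j) *\<^sub>R E))"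
      using assms by (simp add: has_continuous_gradient_def)
    moreover have "((\<lambda>x. U + (x - U $ i $ j) *\<^sub>R E) has_derivative (\<lambda>h. h *\<^sub>R E)) (at (U $ i $ j))"
      by (auto intro!: derivative_eq_intros)
    ultimately have "((\<lambda>x. f (U + (x - U $ i $ j) *\<^sub>R E)) has_derivative (\<lambda>h. g U \<bullet> (h *\<^sub>R E)))
        (at (U $ i $ j))"
      using has_derivative_compose by blast
    moreover have "(\<lambda>h. g U \<bullet> (h *\<^sub>R E)) = (*) (g U $ i $ j)"
      by (simp add: fun_eq_iff E_def inner_axis mult.commute)
    ultimately show "((\<lambda>x. f (\<chi> k l. if k = i \<and> l = j then x else U $ k $ l))
        has_field_derivative g U $ i $ j) (at (U $ i $ j))"
      by (simp add: eq has_field_derivative_def)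
  qed
  then show ?thesis
    by (simp add: fun_eq_iff euclidean_gradient_def vec_eq_iff)
qed

text \<open>\<open>U\<close> times a skew-symmetric matrix is tangent to \<open>O\<^sub>n\<close> at \<open>U\<close>.\<close>

lemma inner_orthogonal_gradient:
  fixes U S :: "real^'n^'n"
  assumes "orthogonal_matrix U" "transpose S = - S"
  shows "orthogonal_gradient f U \<bullet> (U ** S) = euclidean_gradient f U \<bullet> (U ** S)"
proof -
  define P where "P = transpose U ** euclidean_gradient f U"
  have "orthogonal_gradient f U = U ** ((1/2) *\<^sub>R (P - transpose P))"
    by (simp add: orthogonal_gradient_def P_def Let_def matrix_transpose_mul)
  then have "orthogonal_gradient f U \<bullet> (U ** S) = ((1/2) *\<^sub>R (P - transpose P)) \<bullet> S"
    using assms(1)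
    by (simp add: inner_matrix_mult_right matrix_mul_assoc orthogonal_matrix_def)
  \<comment> \<open>Skew-symmetry of \<open>S\<close> flips the sign, so the two halves of the
    projected gradient contribute equally and the factor 1/2 disappears.\<close>
  moreover have "transpose P \<bullet> S = - (P \<bullet> S)"
    using inner_transpose[of P "transpose S"] by (subst (asm) transpose_transpose) (simp add: assms(2))
  ultimately have "orthogonal_gradient f U \<bullet> (U ** S) = P \<bullet> S"
    by (simp add: inner_diff_left)
  then show ?thesis
    by (simp add: P_def inner_matrix_mult_right)
qed

section \<open>The Jacobi iteration\<close>

text \<open>If no angle improved on \<open>f U\<close>, angle 0 would be a maximum, and the
  derivative there, which is the slope, would vanish.\<close>

lemma rotation_increases:
  fixes f :: "real^'n^'n \<Rightarrow> real"
  assumes g: "has_continuous_gradient f g" and U: "orthogonal_matrix U" and ij: "i \<noteq> j"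
    and slope: "orthogonal_gradient f U \<bullet> (U ** rotation_generator i j) \<noteq> 0"
  shows "\<exists>\<psi>. f U < f (U ** rotation i j \<psi>)"
proof (rule ccontr)
  assume "\<nexists>\<psi>. f U < f (U ** rotation i j \<psi>)"
  then have max: "f (U ** rotation i j \<psi>) \<le> f (U ** rotation i j 0)" for \<psi>
    by (simp add: rotation_0 ij not_less)
  let ?S = "rotation_generator i j :: real^'n^'n"
  have lin: "bounded_linear (\<lambda>X. U ** X)"
    by (intro linear_conv_bounded_linear[THEN iffD1] linearI)
       (simp_all add: matrix_add_ldistrib matrix_mult_scaleR)
  have "((\<lambda>\<psi>. U ** rotation i j \<psi>) has_derivative (\<lambda>h. U ** (h *\<^sub>R ?S))) (at 0)"
    using bounded_linear.has_derivative[OF lin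
        has_vector_derivative_rotation[OF ij, unfolded has_vector_derivative_def]] .
  moreover have "(f has_derivative (\<lambda>h. g U \<bullet> h)) (at (U ** rotation i j 0))"
    using g by (simp add: has_continuous_gradient_def rotation_0 ij)
  ultimately have "((\<lambda>\<psi>. f (U ** rotation i j \<psi>)) has_derivative (\<lambda>h. g U \<bullet> (U ** (h *\<^sub>R ?S)))) (at 0)"
    using has_derivative_compose by blast
  moreover have "(\<lambda>h. g U \<bullet> (U ** (h *\<^sub>R ?S))) = (*) (g U \<bullet> (U ** ?S))"
    by (simp add: fun_eq_iff matrix_mult_scaleR)
  ultimately have "DERIV (\<lambda>\<psi>. f (U ** rotation i j \<psi>)) 0 :> g U \<bullet> (U ** ?S)"
    by (simp add: has_field_derivative_def)
  then have "g U \<bullet> (U ** ?S) = 0"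
    by (rule DERIV_local_max[of _ _ _ 1]) (use max in auto)
  then show False
    using slope has_continuous_gradient_imp_euclidean_gradient[OF g]
      inner_orthogonal_gradient[OF U transpose_rotation_generator[OF ij]] by metis
qed

lemma tendsto_orthogonal_gradient:
  fixes f :: "real^'n^'n \<Rightarrow> real"
  assumes g: "has_continuous_gradient f g" and X: "(X \<longlongrightarrow> U) F"
  shows "((\<lambda>k. orthogonal_gradient f (X k)) \<longlongrightarrow> orthogonal_gradient f U) F"
proof -
  have "((\<lambda>k. g (X k)) \<longlongrightarrow> g U) F"
    using has_continuous_gradient_isCont(2)[OF g] X isCont_tendsto_compose by blast
  then show ?thesis
    unfolding orthogonal_gradient_def has_continuous_gradient_imp_euclidean_gradient[OF g] Let_def
    by (intro tendsto_intros X)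
qed

text \<open>Testing the operator norm on a fixed vector \<open>v\<close> turns the pivot condition
  into an inequality whose two sides are visibly continuous in \<open>X\<close>.\<close>

lemma pivot_condition_imp_slope:
  fixes X :: "real^'n^'n"
  assumes "pivot_condition f \<eta> X (i, j)" "i \<noteq> j" "0 < \<eta>"
  shows "\<eta> * norm (orthogonal_gradient f X *v v)
    \<le> \<bar>orthogonal_gradient f X \<bullet> (X ** rotation_generator i j)\<bar> * norm v"
proof -
  have "norm (orthogonal_gradient f X *v v) \<le> onorm ((*v) (orthogonal_gradient f X)) * norm v"
    by (rule onorm) (rule matrix_vector_mul_bounded_linear)
  then have "\<eta> * norm (orthogonal_gradient f X *v v)
      \<le> (\<eta> * onorm ((*v) (orthogonal_gradient f X))) * norm v"
    using assms(3) by (simp add: mult.assoc)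
  also have "\<dots> \<le> \<bar>orthogonal_gradient f X \<bullet> (X ** rotation_generator i j)\<bar> * norm v"
    using assms(1) vector_derivative_at[OF has_vector_derivative_rotation[OF assms(2)]]
    by (intro mult_right_mono) (auto simp: pivot_condition_def)
  finally show ?thesis .
qed

text \<open>The bound by \<open>f U\<close> encodes that a step with this pivot cannot exceed the
  limiting value, which monotonicity supplies along the iteration.\<close>

lemma eventually_no_pivot:
  fixes f :: "real^'n^'n \<Rightarrow> real"
  assumes g: "has_continuous_gradient f g" and U: "orthogonal_matrix U" and ij: "i \<noteq> j"
    and \<eta>: "0 < \<eta>" and nz: "orthogonal_gradient f U \<noteq> 0" and X: "(X \<longlongrightarrow> U) F"
  shows "\<forall>\<^sub>F k in F. \<not> (pivot_condition f \<eta> (X k) (i, j) \<and>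
           (\<forall>\<psi>. f (X k ** rotation i j \<psi>) \<le> f U))"
proof (cases "orthogonal_gradient f U \<bullet> (U ** rotation_generator i j) = 0")
  case True
  obtain v where v: "orthogonal_gradient f U *v v \<noteq> 0"
    using nz by (metis matrix_eq matrix_vector_mult_0)
  \<comment> \<open>The slope at \<open>U\<close> is zero, so the limit is
    \<open>\<eta> * norm (orthogonal_gradient f U *v v)\<close>, which is positive by the choice of
    \<open>v\<close>; the pivot condition would make the difference nonpositive.\<close>
  have "((\<lambda>k. \<eta> * norm (orthogonal_gradient f (X k) *v v)
        - \<bar>orthogonal_gradient f (X k) \<bullet> (X k ** rotation_generator i j)\<bar> * norm v)
      \<longlongrightarrow> \<eta> * norm (orthogonal_gradient f U *v v)
        - \<bar>orthogonal_gradient f U \<bullet> (U ** rotation_generator i j)\<bar> * norm v) F"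
    by (intro tendsto_intros tendsto_orthogonal_gradient[OF g] X)
  then have "\<forall>\<^sub>F k in F. 0 < \<eta> * norm (orthogonal_gradient f (X k) *v v)
        - \<bar>orthogonal_gradient f (X k) \<bullet> (X k ** rotation_generator i j)\<bar> * norm v"
    by (rule order_tendstoD) (use True v \<eta> in simp)
  then show ?thesis
    by eventually_elim (auto simp: not_le dest!: pivot_condition_imp_slope[OF _ ij \<eta>, of _ _ v])
next
  case False
  then obtain \<psi> where \<psi>: "f U < f (U ** rotation i j \<psi>)"
    using rotation_increases[OF g U ij] by blast
  have "((\<lambda>k. f (X k ** rotation i j \<psi>)) \<longlongrightarrow> f (U ** rotation i j \<psi>)) F"
    by (rule isCont_tendsto_compose[OF has_continuous_gradient_isCont(1)[OF g]])
       (intro tendsto_intros X)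
  then have "\<forall>\<^sub>F k in F. f U < f (X k ** rotation i j \<psi>)"
    using \<psi> by (rule order_tendstoD)
  then show ?thesis
    by eventually_elim (auto simp: not_le)
qed

lemma jacobi_sequence_stationary:
  fixes f :: "real^'n::{finite,linorder}^'n::{finite,linorder} \<Rightarrow> real"
  assumes "C1 f" and card: "CARD('n) \<ge> 2" and \<eta>: "0 < \<eta>" and ps: "pivot_ordering ps"
    and jac: "jacobi_sequence f \<eta> ps Us" and r: "strict_mono r" and lim: "(Us \<circ> r) \<longlonglongrightarrow> U"
  shows "stationary_point f U"
proof -
  obtain g where g: "has_continuous_gradient f g"
    using assms(1) by (auto simp: C1_def)
  \<comment> \<open>Two distinct indices make \<open>ps\<close> nonempty, so that lookup modulo its
    length always returns a pair of the list.\<close>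
  obtain a b :: 'n where "a < b"
    using card by (metis card_2_iff' ex_card linorder_neq_iff)
  then have "ps \<noteq> []" and setps: "set ps = {(i, j). i < j}"
    using ps by (auto simp: pivot_ordering_def)
  then have mem: "ps ! (t mod length ps) \<in> {(i, j). i < j}" for t
    by (metis length_greater_0_conv mod_less_divisor nth_mem)
  have U0: "Us 0 = mat 1"
    using jac unfolding jacobi_sequence_def by (rule conjunct1)
  \<comment> \<open>The search times are discarded here: what remains is that every iteration has a
    pivot and that its new value dominates all angles.\<close>
  have step: "\<exists>i j. i < j \<and> pivot_condition f \<eta> (Us k) (i, j) \<and>
      (\<forall>\<psi>. f (Us k ** rotation i j \<psi>) \<le> f (Us (Suc k))) \<and>
      (\<exists>\<phi>. Us (Suc k) = Us k ** rotation i j \<phi>)" for k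
  proof -
    obtain q :: "nat \<Rightarrow> nat" and \<phi> where q:
      "pivot_condition f \<eta> (Us k) (ps ! (q k mod length ps))"
      "case ps ! (q k mod length ps) of (i, j) \<Rightarrow>
         (\<forall>\<psi>. f (Us k ** rotation i j \<psi>) \<le> f (Us k ** rotation i j (\<phi> k))) \<and>
         Us (Suc k) = Us k ** rotation i j (\<phi> k)"
      using jac unfolding jacobi_sequence_def
      by (elim conjE exE, erule_tac x = k in allE) (elim conjE, rule that)
    obtain i j where ij: "ps ! (q k mod length ps) = (i, j)" "i < j"
      using mem[of "q k"] by auto
    note q' = q[unfolded ij prod.case]
    show ?thesis
      unfolding conjunct2[OF q'(2)]
      by (intro exI[of _ i] exI[of _ j] conjI exI[of _ "\<phi> k"] refl ij(2) q'(1) conjunct1[OF q'(2)])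
  qed
  have orth: "orthogonal_matrix (Us k)" for k
  proof (induction k)
    case 0
    show ?case by (simp add: U0 orthogonal_matrix_id)
  next
    case (Suc k)
    then show ?case
      using step[of k] by (metis less_irrefl orthogonal_matrix_mul orthogonal_matrix_rotation)
  qed
  have "orthogonal_matrix U"
    by (rule orthogonal_matrix_limit[OF _ lim]) (simp add: orth)
  \<comment> \<open>Angle 0 leaves the iterate unchanged and competes in the maximization, so no
    step decreases the value.\<close>
  have "incseq (f \<circ> Us)"
  proof (rule incseq_SucI)
    show "(f \<circ> Us) k \<le> (f \<circ> Us) (Suc k)" for k
    proof -
      obtain i j where "i < j" "f (Us k ** rotation i j 0) \<le> f (Us (Suc k))"
        using step[of k] by blast
      then show ?thesis
        by (simp add: rotation_0)
    qed
  qed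
  then have mono: "f (Us k) \<le> f (Us l)" if "k \<le> l" for k l
    using that by (auto simp: incseq_def)
  have "(\<lambda>k. f (Us (r k))) \<longlonglongrightarrow> f U"
    using isCont_tendsto_compose[OF has_continuous_gradient_isCont(1)[OF g] lim] by simp
  moreover have "incseq (\<lambda>k. f (Us (r k)))"
    using r by (simp add: incseq_def mono strict_mono_less_eq)
  ultimately have "f (Us (r k)) \<le> f U" for k
    using incseq_le by blast
  \<comment> \<open>The bound passes from the subsequence to all iterates through
    \<open>k \<le> r k\<close>. This matters because \<open>Us (Suc (r k))\<close> may lie outside
    the subsequence.\<close>
  then have bound: "f (Us k) \<le> f U" for k
    using mono[OF seq_suble[OF r, of k]] by (rule order_trans[rotated])
  have "orthogonal_gradient f U = 0"
  proof (rule ccontr)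
    assume nz: "orthogonal_gradient f U \<noteq> 0"
    \<comment> \<open>Finiteness of \<open>set ps\<close> gives one index at which all pairs are
      excluded together, including the pivot actually used there.\<close>
    have "\<forall>\<^sub>F k in sequentially. \<forall>p\<in>set ps. case p of (i, j) \<Rightarrow>
        \<not> (pivot_condition f \<eta> ((Us \<circ> r) k) (i, j) \<and>
           (\<forall>\<psi>. f ((Us \<circ> r) k ** rotation i j \<psi>) \<le> f U))"
      using eventually_no_pivot[OF g \<open>orthogonal_matrix U\<close> _ \<eta> nz lim]
      by (intro eventually_ball_finite) (auto simp: setps)
    then obtain k where k: "\<forall>p\<in>set ps. case p of (i, j) \<Rightarrow>
        \<not> (pivot_condition f \<eta> ((Us \<circ> r) k) (i, j) \<and>
           (\<forall>\<psi>. f ((Us \<circ> r) k ** rotation i j \<psi>) \<le> f U))"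
      using eventually_happens'[OF sequentially_bot] by blast
    obtain i j where ij: "i < j" "pivot_condition f \<eta> (Us (r k)) (i, j)"
      and le: "\<And>\<psi>. f (Us (r k) ** rotation i j \<psi>) \<le> f (Us (Suc (r k)))"
      using step[of "r k"] by blast
    have "(i, j) \<in> set ps"
      using ij(1) by (simp add: setps)
    with k ij(2) have "\<not> (\<forall>\<psi>. f (Us (r k) ** rotation i j \<psi>) \<le> f U)"
      by fastforce
    then show False
      using order_trans[OF le bound] by simp
  qed
  with \<open>orthogonal_matrix U\<close> show ?thesis
    by (simp add: stationary_point_def)
qed

theorem theorem5p6:
  fixes A :: "'n::{finite,linorder} list \<Rightarrow> real"
    and d :: nat
    and \<eta> :: real
    and ps :: "('n \<times> 'n) list"
    and Us :: "nat \<Rightarrow> real^'n::{finite,linorder}^'n::{finite,linorder}"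
    and r :: "nat \<Rightarrow> nat"
    and U :: "real^'n::{finite,linorder}^'n::{finite,linorder}"
  assumes "d \<ge> 3"
    and "CARD('n) \<ge> 2"
    and "symmetric_tensor d A"
    and "0 < \<eta>" and "\<eta> \<le> 2 / real CARD('n)"
    and "pivot_ordering ps"
    and "jacobi_sequence (trace_fun d A) \<eta> ps Us"
    and "strict_mono r" and "(Us \<circ> r) \<longlonglongrightarrow> U"
  shows "stationary_point (trace_fun d A) U"
  by (rule jacobi_sequence_stationary[OF C1_trace_fun assms(2,4,6-9)])

end
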